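(* Let $\mathfrak g$ be an $I$-central Gårding-Dirichlet polynomial of degree $N$ on $\mathcal S(n)$. Then $$\mathfrak g(A)^{1/N} \ \geq\ \mathfrak g(I)^{1/N}\,(\det A)^{1/n}\qquad \text{for all } A\in\mathcal S(n) \text{ with } A>0.$$
   Context: $\mathcal S(n)$ denotes the vector space of $n\times n$ real symmetric matrices, with inner product $\langle A,B\rangle=\mathrm{tr}(AB)$; $I$ is the identity matrix; $A>0$ means $A$ is positive definite. For a function $F$ on $\mathcal S(n)$ differentiable at $A$, $D_AF\in\mathcal S(n)$ denotes the gradient of $F$ at $A$ with respect to this inner product. Let $\mathfrak g$ be a real homogeneous polynomial of degree $N$ on $\mathcal S(n)$. It is $I$-hyperbolic if $\mathfrak g(I)>0$ and, for each $A\in\mathcal S(n)$, the polynomial $t\mapsto \mathfrak g(tI+A)$ has only real roots. In that case its Gårding cone $\Gamma$ is the connected component of $\{\mathfrak g>0\}$ containing $I$. An $I$-hyperbolic $\mathfrak g$ is a Gårding-Dirichlet polynomial if $\Gamma$ contains $\{A\in\mathcal S(n): A>0\}$. The polynomial $\mathfrak g$ is $I$-central if $D_I\mathfrak g=kI$ for some real $k>0$. *)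

theory Defs
  imports "HOL-Analysis.Analysis" "HOL-Computational_Algebra.Polynomial"
begin

(* Functions on S(n) are represented by functions on all real n x n matrices, of which only
   the values on the subspace sym_mats matter. *)

definition sym_mats :: "(real^'n^'n) set" where
  "sym_mats = {A. transpose A = A}"

definition pos_def :: "real^'n^'n \<Rightarrow> bool" where
  "pos_def A \<longleftrightarrow> A \<in> sym_mats \<and> (\<forall>x. x \<noteq> 0 \<longrightarrow> x \<bullet> (A *v x) > 0)"

definition hom_poly_on_sym :: "nat \<Rightarrow> (real^'n^'n \<Rightarrow> real) \<Rightarrow> bool" where
  "hom_poly_on_sym N g \<longleftrightarrow>
     (\<exists>p. real_polynomial_function p \<and> (\<forall>A\<in>sym_mats. g A = p A)) \<and>
     (\<forall>A\<in>sym_mats. \<forall>t. g (t *\<^sub>R A) = t ^ N * g A)"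

(* The univariate polynomial t |-> g(tI + A), as an element of the polynomial ring, so that
   its non-real roots can be spoken of; it is well defined by poly_line_poly below. *)
definition line_poly :: "(real^'n^'n \<Rightarrow> real) \<Rightarrow> real^'n^'n \<Rightarrow> real poly" where
  "line_poly g A = (THE q. \<forall>t. poly q t = g (t *\<^sub>R mat 1 + A))"

definition only_real_roots :: "real poly \<Rightarrow> bool" where
  "only_real_roots q \<longleftrightarrow> (\<forall>z::complex. poly (map_poly of_real q) z = 0 \<longrightarrow> z \<in> \<real>)"

definition I_hyperbolic :: "nat \<Rightarrow> (real^'n^'n \<Rightarrow> real) \<Rightarrow> bool" where
  "I_hyperbolic N g \<longleftrightarrow> hom_poly_on_sym N g \<and> g (mat 1) > 0 \<and>
     (\<forall>A\<in>sym_mats. only_real_roots (line_poly g A))"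

definition garding_cone :: "(real^'n^'n \<Rightarrow> real) \<Rightarrow> (real^'n^'n) set" where
  "garding_cone g = connected_component_set {A \<in> sym_mats. g A > 0} (mat 1)"

definition garding_dirichlet :: "nat \<Rightarrow> (real^'n^'n \<Rightarrow> real) \<Rightarrow> bool" where
  "garding_dirichlet N g \<longleftrightarrow> I_hyperbolic N g \<and> {A. pos_def A} \<subseteq> garding_cone g"

(* D is the gradient of F at A on the space of symmetric matrices, with respect to the inner
   product tr(AB).  Differentiability is taken within sym_mats only; requiring D to be
   symmetric makes it unique. *)
definition has_sym_gradient ::
    "(real^'n^'n \<Rightarrow> real) \<Rightarrow> real^'n^'n \<Rightarrow> real^'n^'n \<Rightarrow> bool" where
  "has_sym_gradient F A D \<longleftrightarrow> D \<in> sym_mats \<and>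
     (F has_derivative (\<lambda>H. trace (D ** H))) (at A within sym_mats)"

definition I_central :: "(real^'n^'n \<Rightarrow> real) \<Rightarrow> bool" where
  "I_central g \<longleftrightarrow> (\<exists>k>0. has_sym_gradient g (mat 1) (k *\<^sub>R mat 1))"

lemma poly_line_poly:
  fixes g :: "real^'n^'n \<Rightarrow> real"
  assumes "hom_poly_on_sym N g" and A: "A \<in> sym_mats"
  shows "poly (line_poly g A) t = g (t *\<^sub>R mat 1 + A)"
proof -
  obtain p where p: "real_polynomial_function p" "\<And>B. B \<in> sym_mats \<Longrightarrow> g B = p B"
    using assms(1) unfolding hom_poly_on_sym_def by blast
  have sym: "s *\<^sub>R mat 1 + A \<in> sym_mats" for s
    using A by (simp add: sym_mats_def transpose_def vec_eq_iff mat_def)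
  have "polynomial_function (\<lambda>s::real. s *\<^sub>R (mat 1 :: real^'n^'n) + A)"
    by (intro polynomial_function_add polynomial_function_bounded_linear
        bounded_linear_scaleR_left polynomial_function_const)
  from real_polynomial_function_compose[OF this p(1)]
  have "real_polynomial_function (\<lambda>s. p (s *\<^sub>R mat 1 + A))"
    by (simp add: o_def)
  then obtain a m where "(\<lambda>s. p (s *\<^sub>R mat 1 + A)) = (\<lambda>s. \<Sum>i\<le>m. a i * s ^ i)"
    using real_polynomial_function_imp_sum by blast
  then have am: "p (s *\<^sub>R mat 1 + A) = (\<Sum>i\<le>m. a i * s ^ i)" for s
    by (rule fun_cong)
  define q where "q = (\<Sum>i\<le>m. monom (a i) i)"
  have q: "\<forall>s. poly q s = g (s *\<^sub>R mat 1 + A)"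
    using am p(2)[OF sym] by (simp add: q_def poly_sum poly_monom)
  have "\<forall>s. poly (line_poly g A) s = g (s *\<^sub>R mat 1 + A)"
    unfolding line_poly_def
  proof (rule theI[where P = "\<lambda>q. \<forall>s. poly q s = g (s *\<^sub>R mat 1 + A)", OF q])
    fix r assume "\<forall>s. poly r s = g (s *\<^sub>R mat 1 + A)"
    then have "poly r = poly q" using q by (simp add: fun_eq_iff)
    then show "r = q" by (simp only: poly_eq_poly_eq_iff)
  qed
  then show ?thesis by blast
qed

end

theory Submission
  imports Defs "HOL-Computational_Algebra.Fundamental_Theorem_Algebra"
begin

text \<open>Write \<open>A = U diag(x) U\<^sup>T\<close> with \<open>x > 0\<close>. Then \<open>p(x) = g(U diag(x) U\<^sup>T)\<close> is a homogeneous
  polynomial on \<open>\<real>\<^sup>n\<close> that is positive on the positive orthant and hyperbolic in the direction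
  \<open>(1, \<dots>, 1)\<close>. Moving the direction inside the orthant, the complexification of \<open>p\<close> has no zeros
  in the product of right half planes. This property passes to derivatives in positive directions
  (logarithmic derivatives map the half plane to itself). With Euler's identity
  \<open>N p = \<Sum> x\<^sub>i \<partial>\<^sub>i p\<close> and the Cauchy-Schwarz inequality, induction on the degree gives
  \<open>p(\<surd>(x y))\<^sup>2 \<le> p(x) p(y)\<close>, so \<open>log p(exp(t \<xi>))\<close> is midpoint convex in \<open>t\<close>. Comparing
  with its tangent at \<open>t = 0\<close>, where the slope is \<open>(N / n) \<Sum> \<xi>\<^sub>i\<close> because \<open>g\<close> is central, and
  taking \<open>\<xi> = log x\<close> gives the claim.\<close>

section \<open>Complex polynomials and complexification\<close>

lemma poly_eq_if_eq_on_Reals: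
  fixes p q :: "complex poly"
  assumes "\<And>t::real. poly p (of_real t) = poly q (of_real t)"
  shows "p = q"
proof (rule ccontr)
  assume "p \<noteq> q"
  then have "finite {z. poly (p - q) z = 0}"
    by (intro poly_roots_finite) simp
  moreover have "range complex_of_real \<subseteq> {z. poly (p - q) z = 0}"
    using assms by auto
  moreover have "infinite (range complex_of_real)"
    using infinite_UNIV_char_0 by (simp add: finite_image_iff inj_on_def)
  ultimately show False using finite_subset by blast
qed

lemma poly_eq_if_eq_off_0:
  fixes p q :: "complex poly"
  assumes "\<And>s. s \<noteq> 0 \<Longrightarrow> poly p s = poly q s"
  shows "p = q"
proof -
  \<comment> \<open>The factor X makes both sides vanish at 0, the one point about which the
    hypothesis is silent.\<close>
  have "[:0, 1:] * p = [:0, 1:] * q"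
  proof (rule poly_eq_if_eq_on_Reals)
    fix t :: real
    show "poly ([:0, 1:] * p) (of_real t) = poly ([:0, 1:] * q) (of_real t)"
      using assms[of "of_real t"] by (cases "t = 0") auto
  qed
  then show ?thesis by simp
qed

section \<open>Root location for complex polynomials in one variable\<close>

lemma poly_factorized:
  fixes q :: "complex poly"
  obtains root where "\<And>t. poly q t = lead_coeff q * (\<Prod>i<degree q. t - root i)"
    and "\<And>i. i < degree q \<Longrightarrow> poly q (root i) = 0"
proof -
  obtain root where root: "smult (lead_coeff q) (\<Prod>i<degree q. [:-root i, 1:]) = q"
    using complex_poly_decompose' by blast
  have eq: "poly q t = lead_coeff q * (\<Prod>i<degree q. t - root i)" for t
    by (subst root[symmetric]) (simp add: poly_prod)
  moreover have "poly q (root i) = 0" if "i < degree q" for i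
    using that by (auto simp: eq)
  ultimately show ?thesis using that by blast
qed

text \<open>Each linear factor \<open>t - root i\<close> has imaginary part at least
  \<open>Im t\<close>. The bound depends only on degree and leading coefficient, so it is uniform
  over a family sharing both; a value below it forces a root in the upper half plane.\<close>

lemma norm_poly_ge_if_roots_below:
  fixes q :: "complex poly"
  assumes "\<And>x. poly q x = 0 \<Longrightarrow> Im x \<le> 0" and "Im t \<ge> 0"
  shows "norm (poly q t) \<ge> norm (lead_coeff q) * Im t ^ degree q"
proof -
  obtain root where root: "\<And>t. poly q t = lead_coeff q * (\<Prod>i<degree q. t - root i)"
    "\<And>i. i < degree q \<Longrightarrow> poly q (root i) = 0"
    by (metis poly_factorized)
  have "Im t \<le> norm (t - root i)" if "i < degree q" for i
    using assms(1)[OF root(2)[OF that]] abs_Im_le_cmod[of "t - root i"] by simp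
  then have "(\<Prod>i<degree q. Im t) \<le> (\<Prod>i<degree q. norm (t - root i))"
    using assms(2) by (intro prod_mono) auto
  then show ?thesis
    using root(1)[of t] by (simp add: norm_mult prod_norm mult_left_mono)
qed

text \<open>The logarithmic derivative at 0 is the sum of \<open>- inverse (root i)\<close>, and
  inversion preserves the sign of the real part.\<close>

lemma Re_logderiv_pos:
  fixes q :: "complex poly"
  assumes roots: "\<And>x. poly q x = 0 \<Longrightarrow> Re x < 0" and deg: "degree q > 0"
  shows "Re (poly (pderiv q) 0 / poly q 0) > 0"
proof -
  obtain root where root: "\<And>t. poly q t = lead_coeff q * (\<Prod>i<degree q. t - root i)"
    "\<And>i. i < degree q \<Longrightarrow> poly q (root i) = 0"
    by (metis poly_factorized)
  \<comment> \<open>The factors are added one at a time. Strict positivity needs at least one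
    factor, since the empty product has logarithmic derivative 0.\<close>
  have key: "\<exists>d. ((\<lambda>t. \<Prod>i<n. t - root i) has_field_derivative d) (at 0) \<and>
      (\<Prod>i<n. 0 - root i) \<noteq> 0 \<and> Re (d / (\<Prod>i<n. 0 - root i)) \<ge> 0 \<and>
      (n > 0 \<longrightarrow> Re (d / (\<Prod>i<n. 0 - root i)) > 0)"
    if "n \<le> degree q" for n
    using that
  proof (induction n)
    case 0
    show ?case by (rule exI[of _ 0]) auto
  next
    case (Suc n)
    let ?f = "\<lambda>t::complex. \<Prod>i<n. t - root i" and ?y = "root n"
    obtain d where d: "(?f has_field_derivative d) (at 0)" "?f 0 \<noteq> 0" "Re (d / ?f 0) \<ge> 0"
      using Suc by auto
    have y: "Re ?y < 0" "?y \<noteq> 0" using roots[OF root(2)[of n]] Suc.prems by auto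
    let ?e = "d * (0 - ?y) + ?f 0"
    have "((\<lambda>t. ?f t * (t - ?y)) has_field_derivative ?e) (at 0)"
      by (rule derivative_eq_intros d(1) refl | simp)+
    moreover have "?e / (?f 0 * (0 - ?y)) = d / ?f 0 + - inverse ?y"
      using y(2) d(2) by (simp add: divide_simps)
    moreover have "Re (- inverse ?y) > 0"
      using y by (simp add: divide_neg_pos sum_power2_gt_zero_iff complex_eq_iff)
    ultimately have "((\<lambda>t. ?f t * (t - ?y)) has_field_derivative ?e) (at 0)"
      "?f 0 * (0 - ?y) \<noteq> 0" "Re (?e / (?f 0 * (0 - ?y))) > 0"
      using y(2) d(2,3) by simp_all
    then show ?case
      unfolding prod.lessThan_Suc using less_imp_le by blast
  qed
  obtain d where d: "((\<lambda>t. \<Prod>i<degree q. t - root i) has_field_derivative d) (at 0)"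
    and pos: "Re (d / (\<Prod>i<degree q. 0 - root i)) > 0"
    using key[of "degree q"] deg by auto
  have "((\<lambda>t. lead_coeff q * (\<Prod>i<degree q. t - root i)) has_field_derivative (lead_coeff q * d)) (at 0)"
    using d by (rule DERIV_cmult)
  then have "(poly q has_field_derivative (lead_coeff q * d)) (at 0)"
    unfolding root(1)[symmetric] .
  then have "poly (pderiv q) 0 = lead_coeff q * d"
    using DERIV_unique poly_DERIV by blast
  moreover have "lead_coeff q \<noteq> 0" using deg by auto
  ultimately show ?thesis using pos root(1)[of 0] by simp
qed

text \<open>Up to powers of X, \<open>q\<close> is \<open>r\<close> with its coefficients reversed,
  so the constant term of \<open>r\<close> becomes the coefficient of degree
  \<open>N\<close>.\<close>

lemma degree_lead_coeff_if_reflected: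
  fixes q r :: "complex poly"
  assumes "\<And>s. s \<noteq> 0 \<Longrightarrow> poly q s = s ^ N * poly r (1 / s)" and r0: "poly r 0 \<noteq> 0"
  shows "degree q = N" and "lead_coeff q = poly r 0"
proof -
  have eq: "monom 1 (degree r) * q = monom 1 N * reflect_poly r"
  proof (rule poly_eq_if_eq_off_0)
    fix s :: complex assume "s \<noteq> 0"
    then show "poly (monom 1 (degree r) * q) s = poly (monom 1 N * reflect_poly r) s"
      using assms(1) by (simp add: poly_monom poly_reflect_poly_nz inverse_eq_divide)
  qed
  have ne: "reflect_poly r \<noteq> 0" using r0 by auto
  have c0: "coeff r 0 \<noteq> 0" using r0 by (simp add: poly_0_coeff_0)
  have q0: "q \<noteq> 0" using eq ne by auto
  from arg_cong[OF eq, of degree] show "degree q = N"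
    using c0 q0 ne by (simp add: degree_mult_eq degree_monom_eq)
  from arg_cong[OF eq, of lead_coeff] show "lead_coeff q = poly r 0"
    using c0 by (simp add: lead_coeff_mult degree_monom_eq poly_0_coeff_0 coeff_reflect_poly)
qed

text \<open>The inductive form lets restriction to lines and partial derivatives be obtained by
  structural induction, while real constants keep the values at real points real.\<close>

inductive real_cpoly :: "(complex^'n \<Rightarrow> complex) \<Rightarrow> bool" where
  const: "real_cpoly (\<lambda>_. of_real c)"
| coord: "real_cpoly (\<lambda>z. z $ i)"
| add: "real_cpoly P \<Longrightarrow> real_cpoly Q \<Longrightarrow> real_cpoly (\<lambda>z. P z + Q z)"
| mult: "real_cpoly P \<Longrightarrow> real_cpoly Q \<Longrightarrow> real_cpoly (\<lambda>z. P z * Q z)"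

definition cvec :: "real^'n \<Rightarrow> complex^'n" where
  "cvec x = (\<chi> i. of_real (x $ i))"

lemma cvec_nth [simp]: "cvec x $ i = of_real (x $ i)"
  by (simp add: cvec_def)

lemma real_cpoly_sum:
  "(\<And>i. i \<in> S \<Longrightarrow> real_cpoly (P i)) \<Longrightarrow> real_cpoly (\<lambda>z. \<Sum>i\<in>S. P i z)"
proof (induction S rule: infinite_finite_induct)
  case (insert i S)
  then show ?case using real_cpoly.add[of "P i" "\<lambda>z. \<Sum>i\<in>S. P i z"] by simp
qed (use real_cpoly.const[of 0] in auto)

lemma real_cpoly_real: "real_cpoly P \<Longrightarrow> P (cvec x) \<in> \<real>"
  by (induction rule: real_cpoly.induct) auto

lemma real_cpoly_continuous: "real_cpoly P \<Longrightarrow> continuous_on S P"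
  by (induction rule: real_cpoly.induct) (auto intro!: continuous_intros)

text \<open>This is the passage to one variable: zeros and identities in several variables are
  studied on complex lines.\<close>

lemma real_cpoly_line:
  "real_cpoly P \<Longrightarrow> \<exists>q. \<forall>s. P (z + s *s w) = poly q s"
proof (induction rule: real_cpoly.induct)
  case (const c)
  show ?case by (rule exI[of _ "[:of_real c:]"]) simp
next
  case (coord i)
  show ?case by (rule exI[of _ "[:z $ i, w $ i:]"]) simp
next
  case (add P Q)
  then obtain q r where "\<forall>s. P (z + s *s w) = poly q s" "\<forall>s. Q (z + s *s w) = poly r s" by blast
  then show ?case by (intro exI[of _ "q + r"]) simp
next
  case (mult P Q)
  then obtain q r where "\<forall>s. P (z + s *s w) = poly q s" "\<forall>s. Q (z + s *s w) = poly r s" by blast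
  then show ?case by (intro exI[of _ "q * r"]) simp
qed

text \<open>The \<open>Q i\<close> are the partial derivatives, built by the sum and product rules
  so that they stay in the same class. Directional derivatives suffice because all later arguments
  move along lines.\<close>

lemma real_cpoly_partials:
  "real_cpoly P \<Longrightarrow> \<exists>Q. (\<forall>i. real_cpoly (Q i)) \<and>
     (\<forall>z a. ((\<lambda>s. P (z + s *s a)) has_field_derivative (\<Sum>i\<in>UNIV. a $ i * Q i z)) (at 0))"
proof (induction rule: real_cpoly.induct)
  case (const c)
  show ?case
    by (rule exI[of _ "\<lambda>_ _. of_real 0"]) (use real_cpoly.const[of 0] in auto)
next
  case (coord j)
  have "((\<lambda>s. (z + s *s a) $ j) has_field_derivative
     (\<Sum>i\<in>UNIV. a $ i * of_real (if i = j then 1 else 0))) (at 0)" for z a :: "complex^'a"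
    by (auto simp: if_distrib sum.delta cong: if_cong intro!: derivative_eq_intros)
  then show ?case
    by (intro exI[of _ "\<lambda>i _. of_real (if i = j then 1 else 0)"]) (blast intro: real_cpoly.const)
next
  case (add P1 P2)
  then obtain Q1 Q2 where Q: "\<And>i. real_cpoly (Q1 i)" "\<And>i. real_cpoly (Q2 i)"
    "\<And>z a. ((\<lambda>s. P1 (z + s *s a)) has_field_derivative (\<Sum>i\<in>UNIV. a $ i * Q1 i z)) (at 0)"
    "\<And>z a. ((\<lambda>s. P2 (z + s *s a)) has_field_derivative (\<Sum>i\<in>UNIV. a $ i * Q2 i z)) (at 0)"
    by blast
  have "((\<lambda>s. P1 (z + s *s a) + P2 (z + s *s a)) has_field_derivative
     (\<Sum>i\<in>UNIV. a $ i * (Q1 i z + Q2 i z))) (at 0)" for z a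
    using DERIV_add[OF Q(3)[of z a] Q(4)[of z a]] by (simp add: sum.distrib distrib_left)
  then show ?case
    using Q by (intro exI[of _ "\<lambda>i z. Q1 i z + Q2 i z"]) (auto intro: real_cpoly.add)
next
  case (mult P1 P2)
  then obtain Q1 Q2 where Q: "\<And>i. real_cpoly (Q1 i)" "\<And>i. real_cpoly (Q2 i)"
    "\<And>z a. ((\<lambda>s. P1 (z + s *s a)) has_field_derivative (\<Sum>i\<in>UNIV. a $ i * Q1 i z)) (at 0)"
    "\<And>z a. ((\<lambda>s. P2 (z + s *s a)) has_field_derivative (\<Sum>i\<in>UNIV. a $ i * Q2 i z)) (at 0)"
    by blast
  have "((\<lambda>s. P1 (z + s *s a) * P2 (z + s *s a)) has_field_derivative
     (\<Sum>i\<in>UNIV. a $ i * (Q1 i z * P2 z + P1 z * Q2 i z))) (at 0)" for z a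
    using DERIV_mult[OF Q(3)[of z a] Q(4)[of z a]]
    by (simp add: sum.distrib distrib_left sum_distrib_left sum_distrib_right mult_ac)
  then show ?case
    using Q mult.hyps by (intro exI[of _ "\<lambda>i z. Q1 i z * P2 z + P1 z * Q2 i z"])
      (simp add: real_cpoly.add real_cpoly.mult)
qed

lemma complexify_real_polynomial:
  fixes p :: "real^'n \<Rightarrow> real"
  assumes "real_polynomial_function p"
  shows "\<exists>P. real_cpoly P \<and> (\<forall>x. P (cvec x) = of_real (p x))"
  using assms
proof (induction rule: real_polynomial_function.induct)
  case (linear f)
  interpret bounded_linear f by fact
  \<comment> \<open>Linear functionals are primitive on the real side, coordinates on the complex
    side; expansion in the standard basis links the two.\<close>
  have f: "f x = (\<Sum>i\<in>UNIV. f (axis i 1) * x $ i)" for x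
  proof -
    have "f (\<Sum>i\<in>UNIV. x $ i *s axis i 1) = (\<Sum>i\<in>UNIV. f (axis i 1) * x $ i)"
      by (simp only: sum scalar_mult_eq_scaleR scaleR real_scaleR_def mult.commute)
    then show ?thesis by (simp only: basis_expansion)
  qed
  have "real_cpoly (\<lambda>z. \<Sum>i\<in>UNIV. of_real (f (axis i 1)) * z $ i)"
    by (intro real_cpoly_sum real_cpoly.mult real_cpoly.const real_cpoly.coord)
  moreover have "(\<Sum>i\<in>UNIV. of_real (f (axis i 1)) * cvec x $ i) = of_real (f x)" for x
    by (subst f) (simp only: cvec_nth of_real_sum of_real_mult)
  ultimately show ?case by blast
next
  case (const c)
  show ?case by (rule exI[of _ "\<lambda>_. of_real c"]) (simp add: real_cpoly.const)
next
  case (add f g)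
  then obtain P Q where "real_cpoly P" "real_cpoly Q"
    "\<forall>x. P (cvec x) = of_real (f x)" "\<forall>x. Q (cvec x) = of_real (g x)" by blast
  then show ?case by (intro exI[of _ "\<lambda>z. P z + Q z"]) (auto intro: real_cpoly.add)
next
  case (mult f g)
  then obtain P Q where "real_cpoly P" "real_cpoly Q"
    "\<forall>x. P (cvec x) = of_real (f x)" "\<forall>x. Q (cvec x) = of_real (g x)" by blast
  then show ?case by (intro exI[of _ "\<lambda>z. P z * Q z"]) (auto intro: real_cpoly.mult)
qed

section \<open>Zeros of hyperbolic polynomials\<close>

lemma norm_vector_scalar_mult: "norm (c *s v) = norm c * norm (v :: complex^'n)"
  by (simp add: norm_vec_def norm_mult L2_set_right_distrib)

text \<open>Two applications of the identity theorem: for a real factor, from real points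
  \<open>x + s y\<close> to \<open>s = i\<close>; then, at a fixed complex point, from real to
  complex factors.\<close>

lemma real_cpoly_homogeneous:
  fixes P :: "complex^'n \<Rightarrow> complex"
  assumes P: "real_cpoly P"
    and hom: "\<And>(t::real) x. P (cvec (t *s x)) = of_real t ^ N * P (cvec x)"
  shows "P (s *s z) = s ^ N * P z"
proof -
  have real_scale: "P (of_real t *s z) = of_real t ^ N * P z" for t :: real
  proof -
    define x y :: "real^'n" where "x = (\<chi> i. Re (z $ i))" and "y = (\<chi> i. Im (z $ i))"
    obtain q where q: "\<And>s. P (cvec (t *s x) + s *s cvec (t *s y)) = poly q s"
      using real_cpoly_line[OF P] by blast
    obtain r where r: "\<And>s. P (cvec x + s *s cvec y) = poly r s"
      using real_cpoly_line[OF P] by blast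
    have "q = smult (of_real t ^ N) r"
    proof (rule poly_eq_if_eq_on_Reals)
      fix s :: real
      have "cvec (t *s x) + of_real s *s cvec (t *s y) = cvec (t *s (x + s *s y))"
        "cvec x + of_real s *s cvec y = cvec (x + s *s y)"
        by (simp_all add: vec_eq_iff algebra_simps)
      then show "poly q (of_real s) = poly (smult (of_real t ^ N) r) (of_real s)"
        using hom[of t "x + s *s y"] by (simp add: q[symmetric] r[symmetric])
    qed
    then have "poly q \<i> = of_real t ^ N * poly r \<i>" by simp
    moreover have "cvec x + \<i> *s cvec y = z"
      "cvec (t *s x) + \<i> *s cvec (t *s y) = of_real t *s z"
      by (simp_all add: vec_eq_iff complex_eq_iff x_def y_def)
    ultimately show ?thesis using q[of \<i>] r[of \<i>] by simp
  qed
  obtain q where q: "\<And>s. P (0 + s *s z) = poly q s"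
    using real_cpoly_line[OF P] by blast
  have "q = smult (P z) (monom 1 N)"
    by (rule poly_eq_if_eq_on_Reals) (use real_scale q in \<open>simp add: poly_monom q[symmetric]\<close>)
  then show ?thesis using q[of s] by (simp add: poly_monom)
qed

text \<open>The zeros in \<open>t\<close> of the polynomial below are never real, and for \<open>s = 0\<close> they lie in
  the lower half plane; by continuity they stay there as \<open>s\<close> moves to 1.\<close>

lemma hyperbolic_homotopy_nonzero:
  fixes P :: "complex^'n \<Rightarrow> complex"
  assumes P: "real_cpoly P"
    and hom: "\<And>s z. P (s *s z) = s ^ N * P z"
    and hyp: "\<And>w x. P (w *s cvec 1 + cvec x) = 0 \<Longrightarrow> w \<in> \<real>"
    and pos: "\<And>x. (\<And>i. x $ i > 0) \<Longrightarrow> P (cvec x) \<noteq> 0"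
    and y: "\<And>i. y $ i > 0" and \<alpha>: "\<alpha> > 0"
    and t: "Im t \<ge> 0" and s: "s \<in> {0..1}"
  shows "P (of_real s *s cvec x + (\<i> * of_real \<alpha>) *s cvec 1 + t *s cvec y) \<noteq> 0"
proof -
  define v where "v s = of_real s *s cvec x + (\<i> * of_real \<alpha>) *s cvec (1::real^'n)" for s :: real
  define F where "F s t = P (v s + t *s cvec y)" for s t
  \<comment> \<open>For real \<open>t\<close> the argument is i \<alpha> times the all-ones vector
    plus a real vector, so hyperbolicity would make i \<alpha> real.\<close>
  have not_real: "Im t \<noteq> 0" if "F s t = 0" for s t
  proof
    assume "Im t = 0"
    then have "v s + t *s cvec y = (\<i> * of_real \<alpha>) *s cvec 1 + cvec (s *s x + Re t *s y)"
      by (simp add: v_def vec_eq_iff complex_eq_iff)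
    then have "\<i> * of_real \<alpha> \<in> \<real>" using that hyp by (simp add: F_def)
    then show False using \<alpha> by (simp add: complex_is_Real_iff)
  qed
  have init: "F 0 t \<noteq> 0" if "Im t \<ge> 0" for t
  proof
    assume F0: "F 0 t = 0"
    then have t0: "t \<noteq> 0" using not_real by force
    \<comment> \<open>Dividing by \<open>t\<close> exposes a hyperbolic root \<open>w\<close>. It is
      real, and negative because \<open>P\<close> has no zeros on the positive orthant; hence t = i
      \<alpha> / w lies in the lower half plane.\<close>
    define w where "w = \<i> * of_real \<alpha> / t"
    have "v 0 + t *s cvec y = t *s (w *s cvec 1 + cvec y)"
      using t0 by (simp add: v_def w_def vec_eq_iff field_simps)
    then have "t ^ N * P (w *s cvec 1 + cvec y) = 0"
      using F0 by (simp only: F_def hom)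
    then have Pw: "P (w *s cvec 1 + cvec y) = 0" using t0 by simp
    then obtain r where r: "w = of_real r" using hyp Reals_cases by blast
    have "w *s cvec 1 + cvec y = cvec (r *s 1 + y)" by (simp add: r vec_eq_iff)
    then have "\<not> (\<forall>i. r + y $ i > 0)" using Pw pos[of "r *s 1 + y"] by auto
    then have "r < 0" using y by (meson add_nonneg_pos not_le)
    moreover have "of_real r * t = \<i> * of_real \<alpha>"
      using r t0 by (simp add: w_def flip: r)
    then have "Im (of_real r * t) = Im (\<i> * of_real \<alpha>)" by simp
    then have "r * Im t = \<alpha>" by simp
    ultimately show False using that \<alpha> by (metis mult_nonpos_nonneg less_imp_le not_le)
  qed
  \<comment> \<open>Homogeneity makes degree and leading coefficient independent of
    \<open>s\<close>, so the lower bound for polynomials with roots below applies uniformly.\<close>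
  have poly: "\<exists>q. (\<forall>t. F s t = poly q t) \<and> degree q = N \<and> lead_coeff q = P (cvec y)" for s
  proof -
    obtain q where q: "\<And>t. P (v s + t *s cvec y) = poly q t"
      using real_cpoly_line[OF P] by blast
    obtain r where r: "\<And>t. P (cvec y + t *s v s) = poly r t"
      using real_cpoly_line[OF P] by blast
    have r0: "poly r 0 = P (cvec y)" using r[of 0] by simp
    have "poly q t = t ^ N * poly r (1 / t)" if "t \<noteq> 0" for t
    proof -
      have "v s + t *s cvec y = t *s (cvec y + (1 / t) *s v s)"
        using that by (simp add: vec_eq_iff field_simps)
      then show ?thesis by (simp only: q[symmetric] r[symmetric] hom)
    qed
    moreover have "poly r 0 \<noteq> 0" using r0 pos y by simp
    ultimately show ?thesis using degree_lead_coeff_if_reflected[of q N r] q r0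
      by (auto simp: F_def)
  qed
  have cont: "continuous_on UNIV (\<lambda>p. F (fst p) (snd p))"
  proof -
    have "continuous_on UNIV (\<lambda>p. v (fst p) + snd p *s cvec y)"
      unfolding v_def vector_scalar_mult_def cvec_def by (intro continuous_intros)
    then show ?thesis unfolding F_def
      by (rule continuous_on_compose2[OF real_cpoly_continuous[OF P, of UNIV]]) simp
  qed
  \<comment> \<open>The roots are bounded uniformly in \<open>s\<close>: for large \<open>t\<close>,
    dividing by \<open>t\<close> moves the argument into a ball around \<open>cvec y\<close> on
    which \<open>P\<close> is nonzero.\<close>
  obtain B where B: "\<And>s t. s \<in> {0..1} \<Longrightarrow> F s t = 0 \<Longrightarrow> norm t \<le> B"
  proof -
    have "isCont P (cvec y)"
      using real_cpoly_continuous[OF P, of UNIV] by (simp add: continuous_on_eq_continuous_at)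
    moreover have "P (cvec y) \<noteq> 0" using pos y by simp
    ultimately obtain \<delta> where \<delta>: "\<delta> > 0" "\<And>w. dist (cvec y) w < \<delta> \<Longrightarrow> P w \<noteq> 0"
      using continuous_at_avoid by blast
    define M where "M = norm (cvec x) + norm ((\<i> * of_real \<alpha>) *s cvec (1::real^'n))"
    have "norm t \<le> M / \<delta>" if "s \<in> {0..1}" "F s t = 0" for s t
    proof (rule ccontr)
      assume "\<not> norm t \<le> M / \<delta>"
      then have Mt: "M < \<delta> * norm t" using \<delta> by (simp add: field_simps)
      have "M \<ge> 0" by (simp add: M_def)
      then have t0: "t \<noteq> 0" using Mt by auto
      have "norm (v s) \<le> M"
        unfolding v_def M_def using that(1)
        by (intro order_trans[OF norm_triangle_ineq] add_mono) (auto simp: norm_vector_scalar_mult mult_left_le_one_le)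
      then have "norm ((1 / t) *s v s) < \<delta>"
        using Mt t0 by (simp add: norm_vector_scalar_mult norm_divide field_simps)
      then have "P (cvec y + (1 / t) *s v s) \<noteq> 0"
        by (intro \<delta>(2)) (simp add: dist_norm norm_minus_commute)
      moreover have "v s + t *s cvec y = t *s (cvec y + (1 / t) *s v s)"
        using t0 by (simp add: vec_eq_iff field_simps)
      then have "t ^ N * P (cvec y + (1 / t) *s v s) = 0"
        using that(2) by (simp only: F_def hom)
      ultimately show False using t0 by simp
    qed
    then show ?thesis using that by blast
  qed
  \<comment> \<open>\<open>S\<close> collects the parameters with a root in the closed upper half
    plane. It is shown to be clopen in [0, 1] and to omit 0.\<close>
  define S where "S = {s \<in> {0..1}. \<exists>t. Im t \<ge> 0 \<and> F s t = 0}"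
  \<comment> \<open>Closedness: the root bound presents \<open>S\<close> as the projection of a
    compact set.\<close>
  have "S = fst ` (({0..1} \<times> (cball 0 B \<inter> {t. Im t \<ge> 0})) \<inter> {p. F (fst p) (snd p) = 0})"
  proof (intro equalityI subsetI)
    fix s assume "s \<in> S"
    then obtain t where "s \<in> {0..1}" "Im t \<ge> 0" "F s t = 0" by (auto simp: S_def)
    then show "s \<in> fst ` (({0..1} \<times> (cball 0 B \<inter> {t. Im t \<ge> 0})) \<inter> {p. F (fst p) (snd p) = 0})"
      using B by (intro image_eqI[of _ _ "(s, t)"]) auto
  qed (auto simp: S_def)
  moreover have "compact (({0..1} \<times> (cball 0 B \<inter> {t. Im t \<ge> 0})) \<inter> {p. F (fst p) (snd p) = 0})"
    by (intro compact_Int_closed compact_Times compact_cball compact_Icc closed_halfspace_Im_ge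
        closed_Collect_eq cont continuous_on_const)
  ultimately have "compact S"
    by (simp only: compact_continuous_image continuous_on_fst continuous_on_id)
  then have "closed S" by (rule compact_imp_closed)
  then have "closedin (top_of_set {0..1}) S"
    by (intro closed_subset) (auto simp: S_def)
  \<comment> \<open>Openness: if a nearby \<open>s'\<close> were outside \<open>S\<close>, all its
    roots would lie below, so \<open>F s' t\<close> would have norm at least
    \<open>norm (P (cvec y)) * Im t ^ N\<close>. Continuity makes it smaller, since
    \<open>F s t = 0\<close>.\<close>
  moreover have "openin (top_of_set {0..1}) S"
  proof -
    have "\<exists>e>0. ball s e \<inter> {0..1} \<subseteq> S" if sS: "s \<in> S" for s
    proof -
      obtain t where t: "Im t \<ge> 0" "F s t = 0" using sS by (auto simp: S_def)
      then have "Im t > 0" using not_real by force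
      then have "norm (P (cvec y)) * Im t ^ N > 0" using pos y by simp
      moreover have "continuous_on UNIV (\<lambda>s. F s t)"
        using continuous_on_compose2[OF cont, of UNIV "\<lambda>s. (s, t)"]
        by (simp add: continuous_on_Pair)
      then have "isCont (\<lambda>s. F s t) s" by (simp add: continuous_on_eq_continuous_at)
      ultimately obtain e where e: "e > 0"
        "\<And>s'. dist s' s < e \<Longrightarrow> dist (F s' t) (F s t) < norm (P (cvec y)) * Im t ^ N"
        unfolding continuous_at_eps_delta by blast
      have "s' \<in> S" if "s' \<in> ball s e \<inter> {0..1}" for s'
      proof (rule ccontr)
        assume "s' \<notin> S"
        then have roots: "Im w \<le> 0" if "F s' w = 0" for w
          using that \<open>s' \<in> ball s e \<inter> {0..1}\<close> by (auto simp: S_def) (meson linear)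
        obtain q where q: "\<And>t. F s' t = poly q t" "degree q = N" "lead_coeff q = P (cvec y)"
          using poly by blast
        have "norm (P (cvec y)) * Im t ^ N \<le> norm (F s' t)"
          using norm_poly_ge_if_roots_below[of q t] roots q t(1) by auto
        moreover have "norm (F s' t) < norm (P (cvec y)) * Im t ^ N"
          using e(2)[of s'] that t(2) by (simp add: dist_commute)
        ultimately show False by simp
      qed
      then show ?thesis using e(1) by blast
    qed
    moreover have "S \<subseteq> {0..1}" by (auto simp: S_def)
    ultimately show ?thesis by (simp add: openin_contains_ball)
  qed
  moreover have "connected {0..1::real}" by simp
  ultimately have "S = {} \<or> S = {0..1}" unfolding connected_clopen by blast
  moreover have "0 \<notin> S" using init by (auto simp: S_def)
  ultimately have "S = {}" by auto
  then show ?thesis using s t by (auto simp: S_def F_def v_def)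
qed

text \<open>Multiplication by i brings \<open>z\<close> to the endpoint \<open>s = 1\<close>,
  \<open>t = i\<close> of the homotopy, with \<open>x\<close> the negated imaginary part and
  \<open>y\<close> the real part reduced by \<alpha>.\<close>

lemma hyperbolic_right_half_plane_nonzero:
  fixes P :: "complex^'n \<Rightarrow> complex"
  assumes P: "real_cpoly P"
    and hom: "\<And>s z. P (s *s z) = s ^ N * P z"
    and hyp: "\<And>w x. P (w *s cvec 1 + cvec x) = 0 \<Longrightarrow> w \<in> \<real>"
    and pos: "\<And>x. (\<And>i. x $ i > 0) \<Longrightarrow> P (cvec x) \<noteq> 0"
    and z: "\<And>i. Re (z $ i) > 0"
  shows "P z \<noteq> 0"
proof -
  \<comment> \<open>Half the smallest real part is positive and leaves every entry of
    \<open>y\<close> positive.\<close>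
  define \<alpha> where "\<alpha> = Min (range (\<lambda>i. Re (z $ i))) / 2"
  have "Min (range (\<lambda>i. Re (z $ i))) > 0" using z by (subst Min_gr_iff) auto
  then have \<alpha>: "\<alpha> > 0" by (simp add: \<alpha>_def)
  have less: "\<alpha> < Re (z $ i)" for i
  proof -
    have "Min (range (\<lambda>i. Re (z $ i))) \<le> Re (z $ i)" by simp
    then show ?thesis using \<alpha> unfolding \<alpha>_def by linarith
  qed
  define x y :: "real^'n" where "x = (\<chi> i. - Im (z $ i))" and "y = (\<chi> i. Re (z $ i) - \<alpha>)"
  have "P (of_real 1 *s cvec x + (\<i> * of_real \<alpha>) *s cvec 1 + \<i> *s cvec y) \<noteq> 0"
    by (rule hyperbolic_homotopy_nonzero[OF P hom hyp pos _ \<alpha>]) (auto simp: y_def less)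
  also have "of_real 1 *s cvec x + (\<i> * of_real \<alpha>) *s cvec 1 + \<i> *s cvec y = \<i> *s z"
    by (simp add: vec_eq_iff complex_eq_iff x_def y_def)
  finally show ?thesis by (auto simp: hom)
qed

section \<open>Geometric mean convexity\<close>

text \<open>Homogeneity is asked for nonzero scalars, the form that passes to derivatives by
  cancelling a factor \<open>s\<close>. The last clause fixes the sign, which nonvanishing leaves
  open.\<close>

definition rhp_stable :: "nat \<Rightarrow> (complex^'n \<Rightarrow> complex) \<Rightarrow> bool" where
  "rhp_stable N P \<longleftrightarrow> real_cpoly P \<and> (\<forall>s z. s \<noteq> 0 \<longrightarrow> P (s *s z) = s ^ N * P z) \<and>
     (\<forall>z. (\<forall>i. Re (z $ i) > 0) \<longrightarrow> P z \<noteq> 0) \<and>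
     (\<forall>x. (\<forall>i. x $ i > 0) \<longrightarrow> Re (P (cvec x)) > 0)"

text \<open>For fixed \<open>z\<close> in the right half plane all roots of \<open>s \<mapsto> P (z + s a)\<close> have negative real
  part, so the logarithmic derivative of this polynomial at 0 has positive real part.\<close>

lemma rhp_stable_directional_derivative:
  fixes P :: "complex^'n \<Rightarrow> complex"
  assumes P: "rhp_stable (Suc N) P"
    and Q: "\<And>i. real_cpoly (Q i)"
      "\<And>z a. ((\<lambda>s. P (z + s *s a)) has_field_derivative (\<Sum>i\<in>UNIV. a $ i * Q i z)) (at 0)"
    and a: "\<And>i. a $ i > 0"
  shows "rhp_stable N (\<lambda>z. \<Sum>i\<in>UNIV. of_real (a $ i) * Q i z)"
proof -
  define D where "D z = (\<Sum>i\<in>UNIV. of_real (a $ i) * Q i z)" for z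
  have D: "((\<lambda>s. P (z + s *s cvec a)) has_field_derivative D z) (at 0)" for z
    using Q(2)[of z "cvec a"] by (simp add: D_def)
  have Pc: "real_cpoly P" and hom: "\<And>s z. s \<noteq> 0 \<Longrightarrow> P (s *s z) = s ^ Suc N * P z"
    and nz: "\<And>z. (\<And>i. Re (z $ i) > 0) \<Longrightarrow> P z \<noteq> 0"
    and pos: "\<And>x. (\<And>i. x $ i > 0) \<Longrightarrow> Re (P (cvec x)) > 0"
    using P unfolding rhp_stable_def by blast+
  have Dc: "real_cpoly D"
    unfolding D_def using Q(1) by (intro real_cpoly_sum real_cpoly.mult real_cpoly.const)
  have Dhom: "D (s *s z) = s ^ N * D z" if s: "s \<noteq> 0" for s z
  proof -
    have "P (s *s z + \<tau> *s cvec a) = s ^ Suc N * P (z + (\<tau> / s) *s cvec a)" for \<tau>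
    proof -
      have "s *s z + \<tau> *s cvec a = s *s (z + (\<tau> / s) *s cvec a)"
        using s by (simp add: vec_eq_iff field_simps)
      then show ?thesis by (simp only: hom[OF s])
    qed
    moreover have "((\<lambda>\<tau>. s ^ Suc N * P (z + (\<tau> / s) *s cvec a))
        has_field_derivative s ^ Suc N * (D z * (1 / s))) (at 0)"
    proof (rule DERIV_cmult)
      show "((\<lambda>\<tau>. P (z + (\<tau> / s) *s cvec a)) has_field_derivative D z * (1 / s)) (at 0)"
      proof (rule DERIV_chain2[where f = "\<lambda>s. P (z + s *s cvec a)"])
        show "((\<lambda>s. P (z + s *s cvec a)) has_field_derivative D z) (at (0 / s))"
          using D by simp
        show "((\<lambda>\<tau>. \<tau> / s) has_field_derivative 1 / s) (at 0)"
          by (rule DERIV_cdivide) (rule DERIV_ident)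
      qed
    qed
    ultimately have "((\<lambda>\<tau>. P (s *s z + \<tau> *s cvec a))
        has_field_derivative s ^ Suc N * (D z * (1 / s))) (at 0)"
      by simp
    then have "D (s *s z) = s ^ Suc N * (D z * (1 / s))"
      using D DERIV_unique by blast
    then show ?thesis using s by simp
  qed
  have ratio: "Re (D z / P z) > 0" if z: "\<And>i. Re (z $ i) > 0" for z
  proof -
    obtain q where q: "\<And>s. P (z + s *s cvec a) = poly q s"
      using real_cpoly_line[OF Pc] by blast
    have "Re x < 0" if "poly q x = 0" for x
    proof (rule ccontr)
      assume "\<not> Re x < 0"
      then have "Re ((z + x *s cvec a) $ i) > 0" for i
        using z a[of i] by (simp add: add_pos_nonneg)
      then show False using nz that q by metis
    qed
    \<comment> \<open>If \<open>P\<close> were a constant \<open>c\<close> along the line,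
      homogeneity would give P(a + u z) = c u^(N+1) for nonzero \<open>u\<close>, hence also at
      \<open>u = 0\<close>, contradicting that \<open>P\<close> is nonzero at
      \<open>a\<close>.\<close>
    moreover have "degree q > 0"
    proof (rule ccontr)
      assume "\<not> degree q > 0"
      then obtain c where "q = [:c:]" by (metis degree_eq_zeroE gr0I)
      then have c: "P (z + s *s cvec a) = c" for s using q by simp
      obtain r where r: "\<And>u. P (cvec a + u *s z) = poly r u"
        using real_cpoly_line[OF Pc] by blast
      have "r = smult c (monom 1 (Suc N))"
      proof (rule poly_eq_if_eq_off_0)
        fix u :: complex assume u: "u \<noteq> 0"
        then have "cvec a + u *s z = u *s (z + (1 / u) *s cvec a)"
          by (simp add: vec_eq_iff field_simps)
        then have "poly r u = u ^ Suc N * c" by (simp only: r[symmetric] hom[OF u] c)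
        then show "poly r u = poly (smult c (monom 1 (Suc N))) u" by (simp add: poly_monom)
      qed
      then have "P (cvec a) = 0" using r[of 0] by (simp add: poly_monom)
      then show False using nz[of "cvec a"] a by simp
    qed
    ultimately have "Re (poly (pderiv q) 0 / poly q 0) > 0" by (rule Re_logderiv_pos)
    moreover have "poly q 0 = P z" using q[of 0] by simp
    moreover have "poly (pderiv q) 0 = D z"
      using D[of z] poly_DERIV[of q 0] unfolding q by (metis DERIV_unique)
    ultimately show ?thesis by simp
  qed
  \<comment> \<open>At real points both values are real, so the positive ratio transfers the sign of
    \<open>P\<close> to \<open>D\<close>.\<close>
  have "Re (D (cvec x)) > 0" if x: "\<And>i. x $ i > 0" for x
  proof -
    obtain d p where "D (cvec x) = of_real d" "P (cvec x) = of_real p"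
      using real_cpoly_real[OF Dc] real_cpoly_real[OF Pc] by (metis Reals_cases)
    then show ?thesis
      using ratio[of "cvec x"] pos[of x] x by (simp add: zero_less_divide_iff flip: of_real_divide)
  qed
  moreover have "D z \<noteq> 0" if "\<And>i. Re (z $ i) > 0" for z
    using ratio[OF that] by auto
  ultimately show ?thesis
    using Dc Dhom unfolding rhp_stable_def D_def[abs_def] by blast
qed

text \<open>This expresses midpoint convexity of log f in logarithmic coordinates without taking
  logarithms, so that zero values, as for vanishing partial derivatives, are allowed and limits
  preserve it.\<close>

definition geo_mean_convex :: "(real^'n \<Rightarrow> real) \<Rightarrow> bool" where
  "geo_mean_convex f \<longleftrightarrow> (\<forall>x y. (\<forall>i. x $ i > 0) \<longrightarrow> (\<forall>i. y $ i > 0) \<longrightarrow>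
     f x \<ge> 0 \<and> (f (\<chi> i. sqrt (x $ i * y $ i)))\<^sup>2 \<le> f x * f y)"

text \<open>Weak inequalities survive the limit as \<open>e\<close> tends to 0. This carries the
  property from directions inside the orthant to coordinate directions on its boundary.\<close>

lemma geo_mean_convex_limit:
  fixes f :: "real^'n \<Rightarrow> real"
  assumes "\<And>e. e > 0 \<Longrightarrow> geo_mean_convex (\<lambda>x. f x + e * h x)"
  shows "geo_mean_convex f"
  unfolding geo_mean_convex_def
proof (intro allI impI conjI)
  fix x y :: "real^'n" assume xy: "\<forall>i. x $ i > 0" "\<forall>i. y $ i > 0"
  let ?m = "\<chi> i. sqrt (x $ i * y $ i)"
  have lim: "((\<lambda>e. f u + e * h u) \<longlongrightarrow> f u) (at_right 0)" for u
    by (rule tendsto_eq_intros refl | simp)+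
  have ev: "\<forall>\<^sub>F e in at_right (0::real). e > 0" by (rule eventually_at_right_less)
  show "f x \<ge> 0"
    by (rule tendsto_lowerbound[OF lim])
      (use ev assms xy in \<open>auto elim!: eventually_mono simp: geo_mean_convex_def\<close>)
  show "(f ?m)\<^sup>2 \<le> f x * f y"
    by (rule tendsto_le[OF _ tendsto_mult[OF lim lim] tendsto_power[OF lim]])
      (use ev assms xy in \<open>auto elim!: eventually_mono simp: geo_mean_convex_def\<close>)
qed

text \<open>At the geometric mean each summand is at most the geometric mean of the summands at
  \<open>x\<close> and \<open>y\<close>; Cauchy-Schwarz then handles the sum.\<close>

lemma geo_mean_convex_sum_coords:
  fixes f :: "'n \<Rightarrow> real^'n \<Rightarrow> real"
  assumes "\<And>i. geo_mean_convex (f i)"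
  shows "geo_mean_convex (\<lambda>x. \<Sum>i\<in>UNIV. x $ i * f i x)"
  unfolding geo_mean_convex_def
proof (intro allI impI conjI)
  fix x y :: "real^'n" assume xy: "\<forall>i. x $ i > 0" "\<forall>i. y $ i > 0"
  define m where "m = (\<chi> i. sqrt (x $ i * y $ i))"
  have m: "\<forall>i. m $ i > 0" using xy by (simp add: m_def)
  have nn: "f i x \<ge> 0" "f i y \<ge> 0" "f i m \<ge> 0" "(f i m)\<^sup>2 \<le> f i x * f i y" for i
    using assms[of i] xy m unfolding geo_mean_convex_def m_def by blast+
  show "(\<Sum>i\<in>UNIV. x $ i * f i x) \<ge> 0"
    using nn xy by (intro sum_nonneg mult_nonneg_nonneg) (auto intro: less_imp_le)
  have "m $ i * f i m \<le> sqrt (x $ i * f i x) * sqrt (y $ i * f i y)" for i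
  proof -
    have "f i m \<le> sqrt (f i x * f i y)" using nn by (intro real_le_rsqrt)
    then have "m $ i * f i m \<le> m $ i * sqrt (f i x * f i y)"
      using m by (intro mult_left_mono) (auto intro: less_imp_le)
    then show ?thesis by (simp add: m_def real_sqrt_mult mult_ac)
  qed
  then have "(\<Sum>i\<in>UNIV. m $ i * f i m)
      \<le> (\<Sum>i\<in>UNIV. sqrt (x $ i * f i x) * sqrt (y $ i * f i y))"
    by (intro sum_mono)
  moreover have "(\<Sum>i\<in>UNIV. m $ i * f i m) \<ge> 0"
    using nn m by (intro sum_nonneg mult_nonneg_nonneg) (auto intro: less_imp_le)
  ultimately have "(\<Sum>i\<in>UNIV. m $ i * f i m)\<^sup>2
      \<le> (\<Sum>i\<in>UNIV. sqrt (x $ i * f i x) * sqrt (y $ i * f i y))\<^sup>2"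
    by (intro power_mono)
  also have "\<dots> \<le> (\<Sum>i\<in>UNIV. (sqrt (x $ i * f i x))\<^sup>2) * (\<Sum>i\<in>UNIV. (sqrt (y $ i * f i y))\<^sup>2)"
    by (rule Cauchy_Schwarz_ineq_sum)
  also have "\<dots> = (\<Sum>i\<in>UNIV. x $ i * f i x) * (\<Sum>i\<in>UNIV. y $ i * f i y)"
    using nn xy by (simp add: less_imp_le)
  finally show "(\<Sum>i\<in>UNIV. (\<chi> i. sqrt (x $ i * y $ i)) $ i * f i (\<chi> i. sqrt (x $ i * y $ i)))\<^sup>2
      \<le> (\<Sum>i\<in>UNIV. x $ i * f i x) * (\<Sum>i\<in>UNIV. y $ i * f i y)"
    unfolding m_def .
qed

lemma rhp_stable_geo_mean_convex:
  fixes P :: "complex^'n \<Rightarrow> complex"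
  assumes "rhp_stable N P"
  shows "geo_mean_convex (\<lambda>x. Re (P (cvec x)))"
  using assms
proof (induction N arbitrary: P)
  case 0
  \<comment> \<open>In degree 0, \<open>P\<close> is constant on each punctured line through 0,
    hence on the whole line.\<close>
  have const: "P z = P 0" for z
  proof -
    have "real_cpoly P" using 0 by (simp add: rhp_stable_def)
    then obtain q where q: "\<And>s. P (0 + s *s z) = poly q s"
      using real_cpoly_line by blast
    have "q = [:P z:]"
      by (rule poly_eq_if_eq_off_0) (use 0 in \<open>simp add: rhp_stable_def q[symmetric]\<close>)
    then show ?thesis using q[of 0] by simp
  qed
  have "Re (P 0) > 0"
  proof -
    have "Re (P (cvec 1)) > 0" using 0 by (simp add: rhp_stable_def)
    then show ?thesis by (simp add: const[of "cvec 1"])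
  qed
  moreover have "Re (P (cvec x)) = Re (P 0)" for x by (subst const) simp
  ultimately show ?case by (simp add: geo_mean_convex_def power2_eq_square)
next
  case (Suc N)
  then have P: "real_cpoly P" "\<And>s z. s \<noteq> 0 \<Longrightarrow> P (s *s z) = s ^ Suc N * P z"
    unfolding rhp_stable_def by blast+
  obtain Q where Q: "\<And>i. real_cpoly (Q i)"
    "\<And>z a. ((\<lambda>s. P (z + s *s a)) has_field_derivative (\<Sum>i\<in>UNIV. a $ i * Q i z)) (at 0)"
    using real_cpoly_partials[OF P(1)] by blast
  have "geo_mean_convex (\<lambda>x. Re (Q i (cvec x)))" for i
  proof (rule geo_mean_convex_limit)
    fix e :: real assume "e > 0"
    \<comment> \<open>A strictly positive perturbation of the \<open>i\<close>-th coordinate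
      direction, as stability of derivatives requires.\<close>
    define a :: "real^'n" where "a = (\<chi> j. (if j = i then 1 else 0) + e)"
    have "rhp_stable N (\<lambda>z. \<Sum>j\<in>UNIV. of_real (a $ j) * Q j z)"
      by (rule rhp_stable_directional_derivative[OF Suc.prems Q]) (use \<open>e > 0\<close> in \<open>simp add: a_def\<close>)
    then have "geo_mean_convex (\<lambda>x. Re (\<Sum>j\<in>UNIV. of_real (a $ j) * Q j (cvec x)))"
      by (rule Suc.IH)
    moreover have "Re (\<Sum>j\<in>UNIV. of_real (a $ j) * Q j (cvec x))
        = Re (Q i (cvec x)) + e * (\<Sum>j\<in>UNIV. Re (Q j (cvec x)))" for x
    proof -
      have "a $ j * Re (Q j (cvec x))
          = (if j = i then Re (Q j (cvec x)) else 0) + e * Re (Q j (cvec x))" for j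
        by (simp add: a_def distrib_right)
      then show ?thesis by (simp add: sum.distrib sum_distrib_left)
    qed
    ultimately show "geo_mean_convex (\<lambda>x. Re (Q i (cvec x)) + e * (\<Sum>j\<in>UNIV. Re (Q j (cvec x))))"
      by simp
  qed
  then have *: "geo_mean_convex (\<lambda>x. \<Sum>i\<in>UNIV. x $ i * Re (Q i (cvec x)))"
    by (rule geo_mean_convex_sum_coords)
  \<comment> \<open>Euler's identity, from differentiating the homogeneity relation for the factor 1
    + s at \<open>s = 0\<close>; the point -1 is excluded because there the factor vanishes.\<close>
  have "(\<Sum>i\<in>UNIV. z $ i * Q i z) = of_nat (Suc N) * P z" for z
  proof -
    have "((\<lambda>s. (1 + s) ^ Suc N * P z) has_field_derivative of_nat (Suc N) * P z) (at 0)"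
      by (rule derivative_eq_intros refl | simp)+
    moreover have "(1 + s) ^ Suc N * P z = P (z + s *s z)" if "s \<in> - {-1}" for s
    proof -
      have "z + s *s z = (1 + s) *s z" by (simp add: vec_eq_iff algebra_simps)
      moreover have "1 + s \<noteq> 0" using that by (auto simp: add_eq_0_iff)
      ultimately show ?thesis by (simp only: P(2)[of "1 + s" z] not_False_eq_True)
    qed
    ultimately have "((\<lambda>s. P (z + s *s z)) has_field_derivative of_nat (Suc N) * P z) (at 0)"
      by (elim has_field_derivative_transform_within_open[where S = "- {-1}"]) auto
    then show ?thesis using Q(2) DERIV_unique by blast
  qed
  then have euler: "(\<Sum>i\<in>UNIV. cvec x $ i * Q i (cvec x)) = of_nat (Suc N) * P (cvec x)" for x
    by blast
  have "(\<Sum>i\<in>UNIV. x $ i * Re (Q i (cvec x))) = real (Suc N) * Re (P (cvec x))" for x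
  proof -
    have "Re (\<Sum>i\<in>UNIV. cvec x $ i * Q i (cvec x)) = Re (of_real (real (Suc N)) * P (cvec x))"
      by (simp only: euler of_real_of_nat_eq)
    then show ?thesis by (simp del: of_nat_Suc)
  qed
  with * have "geo_mean_convex (\<lambda>x. real (Suc N) * Re (P (cvec x)))" by simp
  moreover have "geo_mean_convex f" if "geo_mean_convex (\<lambda>x. c * f x)" "c > 0"
    for c :: real and f :: "real^'n \<Rightarrow> real"
  proof -
    have "(c * u)\<^sup>2 \<le> c * v * (c * w) \<longleftrightarrow> u\<^sup>2 \<le> v * w" for u v w
      using that(2) by (simp add: power_mult_distrib power2_eq_square mult_ac)
    then show ?thesis using that by (simp add: geo_mean_convex_def zero_le_mult_iff)
  qed
  ultimately show ?case by (metis of_nat_0_less_iff zero_less_Suc)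
qed

section \<open>Diagonalization of symmetric matrices\<close>

text \<open>A maximizer of the Rayleigh quotient on the unit sphere of \<open>S\<close> is an
  eigenvector, because its first variation vanishes.\<close>

lemma self_adjoint_eigenvector:
  fixes f :: "'a::euclidean_space \<Rightarrow> 'a"
  assumes f: "linear f" and adj: "\<And>x y. f x \<bullet> y = x \<bullet> f y"
    and S: "subspace S" "f ` S \<subseteq> S" "S \<noteq> {0}"
  obtains v c where "v \<in> S" "norm v = 1" "f v = c *\<^sub>R v"
proof -
  interpret linear f by fact
  obtain x where x: "x \<in> S" "x \<noteq> 0" using S subspace_0 by blast
  have "x /\<^sub>R norm x \<in> sphere 0 1 \<inter> S"
    using x S(1) by (simp add: subspace_scale)
  moreover have "compact (sphere 0 1 \<inter> S)"
    by (intro compact_Int_closed compact_sphere closed_subspace S)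
  moreover have "continuous_on (sphere 0 1 \<inter> S) (\<lambda>x. x \<bullet> f x)"
    by (intro continuous_intros linear_continuous_on linear_linear[THEN iffD2] f)
  ultimately obtain v where v: "v \<in> sphere 0 1 \<inter> S"
    and max: "\<And>y. y \<in> sphere 0 1 \<inter> S \<Longrightarrow> y \<bullet> f y \<le> v \<bullet> f v"
    using continuous_attains_sup[of "sphere 0 1 \<inter> S" "\<lambda>x. x \<bullet> f x"] by blast
  define c where "c = v \<bullet> f v"
  have le: "y \<bullet> f y \<le> c * (y \<bullet> y)" if y: "y \<in> S" for y
  proof (cases "y = 0")
    case False
    then have "(y /\<^sub>R norm y) \<bullet> f (y /\<^sub>R norm y) \<le> c"
      unfolding c_def using y S(1) by (intro max) (simp add: subspace_scale)
    then have "(y \<bullet> f y) / (norm y)\<^sup>2 \<le> c"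
      by (simp add: scale power2_eq_square field_simps)
    then show ?thesis using False by (simp add: power2_norm_eq_inner divide_simps)
  qed (simp add: zero)
  \<comment> \<open>The residual is itself the test direction: varying \<open>v\<close> along
    \<open>w\<close> has first-order effect \<open>2 * (w \<bullet> w)\<close>.\<close>
  define w where "w = f v - c *\<^sub>R v"
  have wS: "w \<in> S" using v S by (auto simp: w_def intro!: subspace_diff subspace_scale)
  define d where "d = w \<bullet> f w - c * (w \<bullet> w)"
  have quad: "2 * t * (w \<bullet> w) + t\<^sup>2 * d \<le> 0" for t :: real
  proof -
    have "v + t *\<^sub>R w \<in> S" using v wS S(1) by (simp add: subspace_add subspace_scale)
    then have "(v + t *\<^sub>R w) \<bullet> f (v + t *\<^sub>R w) - c * ((v + t *\<^sub>R w) \<bullet> (v + t *\<^sub>R w)) \<le> 0"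
      using le by simp
    moreover have "(v + t *\<^sub>R w) \<bullet> f (v + t *\<^sub>R w) - c * ((v + t *\<^sub>R w) \<bullet> (v + t *\<^sub>R w))
        = 2 * t * (w \<bullet> w) + t\<^sup>2 * d"
    proof -
      have vv: "v \<bullet> v = 1" using v by (simp add: norm_eq_1)
      have "f v = w + c *\<^sub>R v" by (simp add: w_def)
      then have wfv: "w \<bullet> f v = w \<bullet> w + c * (v \<bullet> w)"
        by (simp add: inner_add_right inner_commute)
      have vfw: "v \<bullet> f w = w \<bullet> f v" using adj[of v w] by (simp add: inner_commute)
      have e1: "(v + t *\<^sub>R w) \<bullet> f (v + t *\<^sub>R w)
          = v \<bullet> f v + t * (v \<bullet> f w) + t * (w \<bullet> f v) + t\<^sup>2 * (w \<bullet> f w)"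
        unfolding add scale
        by (simp add: inner_add_left inner_add_right power2_eq_square algebra_simps)
      have e2: "(v + t *\<^sub>R w) \<bullet> (v + t *\<^sub>R w) = v \<bullet> v + 2 * t * (v \<bullet> w) + t\<^sup>2 * (w \<bullet> w)"
        by (simp add: inner_add_left inner_add_right inner_commute[of w v] power2_eq_square algebra_simps)
      show ?thesis
        unfolding e1 e2 vfw wfv vv d_def c_def[symmetric] by (simp only: algebra_simps)
    qed
    ultimately show ?thesis by linarith
  qed
  have "w = 0"
  proof (rule ccontr)
    assume "w \<noteq> 0"
    then have b: "w \<bullet> w > 0" by simp
    \<comment> \<open>Small enough that the second-order term \<open>t * d\<close> costs at most one
      of the two copies of \<open>w \<bullet> w\<close>.\<close>
    define t where "t = (w \<bullet> w) / (\<bar>d\<bar> + 1)"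
    have t: "t > 0" using b by (simp add: t_def)
    have "t * \<bar>d\<bar> \<le> w \<bullet> w" using b by (simp add: t_def field_simps)
    moreover have "- (t * d) \<le> t * \<bar>d\<bar>" using t by (simp add: abs_if)
    ultimately have "2 * (w \<bullet> w) + t * d > 0" using b by linarith
    then have "t * (2 * (w \<bullet> w) + t * d) > 0" using t by simp
    then show False using quad[of t] by (simp add: algebra_simps power2_eq_square)
  qed
  then show ?thesis using that[of v c] v by (simp add: w_def)
qed

text \<open>The orthogonal complement of the eigenvectors found so far is invariant under
  \<open>f\<close> and nonzero while fewer than \<open>DIM('a)\<close> are chosen, so it supplies
  the next one.\<close>

lemma self_adjoint_orthonormal_eigenvectors:
  fixes f :: "'a::euclidean_space \<Rightarrow> 'a"
  assumes f: "linear f" and adj: "\<And>x y. f x \<bullet> y = x \<bullet> f y" and "k \<le> DIM('a)"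
  shows "\<exists>B. card B = k \<and> finite B \<and> pairwise orthogonal B \<and>
    (\<forall>b\<in>B. norm b = 1 \<and> (\<exists>c. f b = c *\<^sub>R b))"
  using \<open>k \<le> DIM('a)\<close>
proof (induction k)
  case 0
  show ?case by (rule exI[of _ "{}"]) simp
next
  case (Suc k)
  then obtain B where B: "card B = k" "finite B" "pairwise orthogonal B"
    "\<And>b. b \<in> B \<Longrightarrow> norm b = 1" "\<And>b. b \<in> B \<Longrightarrow> \<exists>c. f b = c *\<^sub>R b"
    by auto
  define S where "S = {x. \<forall>b\<in>B. b \<bullet> x = 0}"
  have "subspace S"
    by (auto simp: S_def subspace_def inner_add_right)
  moreover have "f ` S \<subseteq> S"
  proof -
    have "b \<bullet> f x = 0" if xS: "x \<in> S" and bB: "b \<in> B" for x b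
    proof -
      obtain c where "f b = c *\<^sub>R b" using B(5) bB by blast
      then show ?thesis using adj[of b x] xS bB by (simp add: S_def)
    qed
    then show ?thesis by (auto simp: S_def)
  qed
  moreover have "S \<noteq> {0}"
  proof -
    have "dim B < DIM('a)" using dim_le_card'[OF B(2)] B(1) Suc.prems by linarith
    then obtain x where "x \<noteq> 0" "\<And>y. y \<in> span B \<Longrightarrow> orthogonal x y"
      using orthogonal_to_subspace_exists by blast
    then have "x \<in> S" by (auto simp: S_def orthogonal_def inner_commute span_base)
    then show ?thesis using \<open>x \<noteq> 0\<close> by blast
  qed
  ultimately obtain v c where v: "v \<in> S" "norm v = 1" "f v = c *\<^sub>R v"
    using self_adjoint_eigenvector[OF f adj] by metis
  have "v \<notin> B"
  proof
    assume "v \<in> B"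
    then have "v \<bullet> v = 0" using v(1) by (simp add: S_def)
    then show False using v(2) by simp
  qed
  moreover have "pairwise orthogonal (insert v B)"
    using B(3) v(1) by (auto simp: pairwise_insert S_def orthogonal_def inner_commute)
  ultimately show ?case
    using B v by (intro exI[of _ "insert v B"]) auto
qed

definition diagonal :: "real^'n \<Rightarrow> real^'n^'n" where
  "diagonal x = (\<chi> i j. if i = j then x $ i else 0)"

lemma diagonal_mult_vec: "(diagonal x *v y) $ i = x $ i * y $ i"
  by (simp add: diagonal_def matrix_vector_mult_def mult_delta_left)

text \<open>The columns of \<open>U\<close> form an orthonormal eigenbasis, so \<open>A ** U\<close>
  merely scales the columns of \<open>U\<close>.\<close>

lemma symmetric_matrix_diagonalizable:
  fixes A :: "real^'n^'n"
  assumes "transpose A = A"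
  obtains U x where "orthogonal_matrix U" "A = U ** diagonal x ** transpose U"
proof -
  have adj: "(A *v x) \<bullet> y = x \<bullet> (A *v y)" for x y
    using dot_lmul_matrix[of x A y] transpose_matrix_vector[of A x] assms by simp
  obtain B where B: "card B = CARD('n)" "finite B" "pairwise orthogonal B"
    "\<And>b. b \<in> B \<Longrightarrow> norm b = 1" "\<And>b. b \<in> B \<Longrightarrow> \<exists>c. A *v b = c *\<^sub>R b"
    using self_adjoint_orthonormal_eigenvectors[OF matrix_vector_mul_linear[of A] adj, of "CARD('n)"]
    by auto
  obtain h where h: "bij_betw h (UNIV :: 'n set) B"
    using finite_same_card_bij[of "UNIV :: 'n set" B] B by auto
  then have hB: "h i \<in> B" for i by (auto simp: bij_betw_def)
  have "\<forall>i. \<exists>c. A *v h i = c *\<^sub>R h i" using B(5)[OF hB] by (rule allI)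
  from choice[OF this] obtain l where l: "\<And>i. A *v h i = l i *\<^sub>R h i" by blast
  define U where "U = (\<chi> j i. h i $ j)"
  have hh: "h i \<bullet> h j = (if i = j then 1 else 0)" for i j
  proof (cases "i = j")
    case True
    then show ?thesis using B(4)[OF hB] by (simp only: norm_eq_1 if_True simp_thms)
  next
    case False
    then have "h i \<noteq> h j" using h by (metis UNIV_I bij_betw_def inj_onD)
    then have "orthogonal (h i) (h j)" using pairwiseD[OF B(3) hB hB] by blast
    then show ?thesis using False by (simp only: orthogonal_def if_False)
  qed
  have "(transpose U ** U) $ i $ j = h i \<bullet> h j" for i j
    by (simp add: transpose_def U_def matrix_matrix_mult_def inner_vec_def)
  then have U: "orthogonal_matrix U"
    by (simp add: orthogonal_matrix vec_eq_iff hh mat_def)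
  have "(A ** U) $ j $ i = (A *v h i) $ j" for i j
    by (simp add: U_def matrix_matrix_mult_def matrix_vector_mult_def)
  moreover have "(U ** diagonal (\<chi> i. l i)) $ j $ i = h i $ j * l i" for i j
    by (simp add: U_def matrix_matrix_mult_def diagonal_def mult_delta_right)
  ultimately have "A ** U = U ** diagonal (\<chi> i. l i)"
    by (simp add: vec_eq_iff l)
  then have "A ** (U ** transpose U) = U ** diagonal (\<chi> i. l i) ** transpose U"
    by (simp add: matrix_mul_assoc)
  then have "A = U ** diagonal (\<chi> i. l i) ** transpose U"
    using U by (simp add: orthogonal_matrix_def)
  then show ?thesis using that U by blast
qed

lemma
  fixes U :: "real^'n^'n"
  assumes U: "orthogonal_matrix U"
  shows linear_conj_diagonal: "linear (\<lambda>x. U ** diagonal x ** transpose U)"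
    and conj_diagonal_1: "U ** diagonal 1 ** transpose U = mat 1"
    and sym_conj_diagonal: "U ** diagonal x ** transpose U \<in> sym_mats"
    and pos_def_conj_diagonal: "pos_def (U ** diagonal x ** transpose U) \<longleftrightarrow> (\<forall>i. x $ i > 0)"
    and trace_conj_diagonal: "trace (U ** diagonal x ** transpose U) = (\<Sum>i\<in>UNIV. x $ i)"
    and det_conj_diagonal: "det (U ** diagonal x ** transpose U) = (\<Prod>i\<in>UNIV. x $ i)"
proof -
  have UU: "U ** transpose U = mat 1" "transpose U ** U = mat 1"
    using U by (simp_all add: orthogonal_matrix_def)
  show "linear (\<lambda>x. U ** diagonal x ** transpose U)"
  proof (rule linearI)
    fix x y :: "real^'n" and c :: real
    have "diagonal (x + y) = diagonal x + diagonal y"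
      by (simp add: diagonal_def vec_eq_iff)
    moreover have "(B + C) ** transpose U = B ** transpose U + C ** transpose U" for B C
      by (simp add: vec_eq_iff matrix_matrix_mult_def sum.distrib distrib_right)
    ultimately show "U ** diagonal (x + y) ** transpose U
        = U ** diagonal x ** transpose U + U ** diagonal y ** transpose U"
      by (simp only: matrix_add_ldistrib)
    have "diagonal (c *\<^sub>R x) = c *\<^sub>R diagonal x"
      by (simp add: diagonal_def vec_eq_iff)
    then show "U ** diagonal (c *\<^sub>R x) ** transpose U = c *\<^sub>R (U ** diagonal x ** transpose U)"
      by (simp only: matrix_scalar_ac scalar_matrix_assoc)
  qed
  have "diagonal (1::real^'n) = mat 1" by (simp add: diagonal_def mat_def vec_eq_iff)
  then show "U ** diagonal 1 ** transpose U = mat 1" using UU by simp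
  have "transpose (diagonal x) = diagonal x"
    by (auto simp: diagonal_def transpose_def vec_eq_iff)
  then show sym: "U ** diagonal x ** transpose U \<in> sym_mats"
    by (simp add: sym_mats_def matrix_transpose_mul matrix_mul_assoc)
  have quad: "y \<bullet> ((U ** diagonal x ** transpose U) *v y)
      = (\<Sum>i\<in>UNIV. x $ i * ((transpose U *v y) $ i)\<^sup>2)" for y
  proof -
    have "y \<bullet> ((U ** diagonal x ** transpose U) *v y)
        = (transpose U *v y) \<bullet> (diagonal x *v (transpose U *v y))"
      by (simp add: matrix_vector_mul_assoc[symmetric] dot_lmul_matrix)
    then show ?thesis
      by (simp add: inner_vec_def diagonal_mult_vec power2_eq_square mult_ac)
  qed
  show "pos_def (U ** diagonal x ** transpose U) \<longleftrightarrow> (\<forall>i. x $ i > 0)"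
  proof
    assume pd: "pos_def (U ** diagonal x ** transpose U)"
    show "\<forall>i. x $ i > 0"
    proof
      fix i
      \<comment> \<open>The quadratic form is tested on the \<open>i\<close>-th column of
        \<open>U\<close>, where it equals \<open>x $ i\<close>.\<close>
      have eq: "transpose U *v (U *v axis i 1) = axis i 1"
        by (simp only: matrix_vector_mul_assoc UU matrix_vector_mul_lid)
      have "U *v axis i 1 \<noteq> 0"
      proof
        assume "U *v axis i 1 = 0"
        then have "axis i 1 = (0 :: real^'n)" using eq by (simp only: matrix_vector_mult_0_right)
        then show False by (simp add: axis_eq_0_iff)
      qed
      then have "(\<Sum>j\<in>UNIV. x $ j * (axis i (1::real) $ j)\<^sup>2) > 0"
        using pd quad[of "U *v axis i 1"] unfolding eq pos_def_def by metis
      moreover have "x $ j * (axis i (1::real) $ j)\<^sup>2 = (if j = i then x $ j else 0)" for j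
        by (simp add: axis_def)
      ultimately show "x $ i > 0" by simp
    qed
  next
    assume pos: "\<forall>i. x $ i > 0"
    have "y \<bullet> ((U ** diagonal x ** transpose U) *v y) > 0" if "y \<noteq> 0" for y
    proof -
      have "transpose U *v y \<noteq> 0"
      proof
        assume "transpose U *v y = 0"
        then have "(U ** transpose U) *v y = 0"
          by (simp only: matrix_vector_mul_assoc[symmetric] matrix_vector_mult_0_right)
        then show False using that by (simp add: UU)
      qed
      then obtain i where "(transpose U *v y) $ i \<noteq> 0" by (auto simp only: vec_eq_iff zero_index)
      then show ?thesis
        unfolding quad using pos
        by (intro sum_pos2[of _ i]) (auto simp: less_imp_le)
    qed
    then show "pos_def (U ** diagonal x ** transpose U)" using sym by (simp add: pos_def_def)
  qed
  have "trace (U ** diagonal x ** transpose U) = trace (diagonal x ** (transpose U ** U))"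
    by (metis trace_mul_sym matrix_mul_assoc)
  then show "trace (U ** diagonal x ** transpose U) = (\<Sum>i\<in>UNIV. x $ i)"
    by (simp add: UU) (simp add: trace_def diagonal_def)
  have "det U * det U = det (U ** transpose U)" by (simp add: det_mul)
  then have "det U * det U = 1" by (simp add: UU)
  moreover have "det (diagonal x) = (\<Prod>i\<in>UNIV. x $ i)"
    by (subst det_diagonal) (auto simp: diagonal_def)
  ultimately show "det (U ** diagonal x ** transpose U) = (\<Prod>i\<in>UNIV. x $ i)"
    by (simp add: det_mul mult.commute mult.left_commute)
qed

section \<open>Determinant majorization\<close>

text \<open>Difference quotients from 0 do not increase when the step is halved, so their limit
  \<open>d\<close> is at most the quotient with step 1.\<close>

lemma midpoint_convex_derivative_le:
  fixes h :: "real \<Rightarrow> real"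
  assumes mid: "\<And>t. 2 * h t \<le> h 0 + h (2 * t)"
    and h': "(h has_real_derivative d) (at 0)"
  shows "h 0 + d \<le> h 1"
proof -
  have le: "(h ((1/2) ^ m) - h 0) / (1/2) ^ m \<le> h 1 - h 0" for m
  proof (induction m)
    case (Suc m)
    have "(h ((1/2) ^ Suc m) - h 0) / (1/2) ^ Suc m = (2 * h ((1/2) ^ Suc m) - 2 * h 0) / (1/2) ^ m"
      by (simp add: field_simps)
    also have "\<dots> \<le> (h ((1/2) ^ m) - h 0) / (1/2) ^ m"
      using mid[of "(1/2) ^ Suc m"] by (intro divide_right_mono) auto
    also note Suc.IH
    finally show ?case .
  qed simp
  have "(\<lambda>t. (h t - h 0) / t) \<midarrow>0\<rightarrow> d"
    using h' by (simp add: DERIV_def)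
  moreover have "(\<lambda>m. (1/2::real) ^ m) \<longlonglongrightarrow> 0"
    by (rule LIMSEQ_realpow_zero) auto
  then have "filterlim (\<lambda>m. (1/2::real) ^ m) (at 0) sequentially"
    by (simp add: filterlim_at)
  ultimately have "(\<lambda>m. (h ((1/2) ^ m) - h 0) / (1/2) ^ m) \<longlonglongrightarrow> d"
    by (rule filterlim_compose)
  then have "d \<le> h 1 - h 0"
    by (rule LIMSEQ_le_const2) (use le in blast)
  then show ?thesis by simp
qed

lemma geo_mean_convex_tangent:
  fixes f :: "real^'n \<Rightarrow> real"
  assumes f: "geo_mean_convex f" and pos: "\<And>x. (\<And>i. x $ i > 0) \<Longrightarrow> f x > 0"
    and f': "((\<lambda>t. f (\<chi> i. exp (t * \<xi> $ i))) has_real_derivative d) (at 0)"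
  shows "ln (f 1) + d / f 1 \<le> ln (f (\<chi> i. exp (\<xi> $ i)))"
proof -
  define e where "e t = (\<chi> i. exp (t * \<xi> $ i))" for t :: real
  have e0: "e 0 = 1" by (simp add: e_def vec_eq_iff)
  have fe: "f (e t) > 0" for t by (intro pos) (simp add: e_def)
  have "2 * ln (f (e t)) \<le> ln (f (e 0)) + ln (f (e (2 * t)))" for t
  proof -
    \<comment> \<open>This makes \<open>e t\<close> the coordinatewise geometric mean of
      \<open>e 0\<close> and \<open>e (2 * t)\<close>.\<close>
    have "sqrt (exp (2 * u)) = exp u" for u :: real
      by (simp add: exp_double)
    then have "(\<chi> i. sqrt (e 0 $ i * e (2 * t) $ i)) = e t"
      by (simp add: e_def mult.assoc)
    then have "(f (e t))\<^sup>2 \<le> f (e 0) * f (e (2 * t))"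
      using f[unfolded geo_mean_convex_def, rule_format, of "e 0" "e (2 * t)"]
      by (simp add: e_def)
    then have "ln ((f (e t))\<^sup>2) \<le> ln (f (e 0) * f (e (2 * t)))"
      using fe[of t] fe[of 0] fe[of "2 * t"] by (subst ln_le_cancel_iff) auto
    then show ?thesis
      using fe[of t] fe[of 0] fe[of "2 * t"] by (simp add: ln_mult ln_realpow)
  qed
  moreover have "((\<lambda>t. ln (f (e t))) has_real_derivative d / f 1) (at 0)"
    using f' fe[of 0] by (auto intro!: derivative_eq_intros simp: e0 e_def[symmetric])
  ultimately have "ln (f (e 0)) + d / f 1 \<le> ln (f (e 1))"
    by (rule midpoint_convex_derivative_le)
  then show ?thesis by (simp add: e0) (simp add: e_def)
qed

text \<open>The chain rule for differentiability within \<open>sym_mats\<close>, which is why the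
  whole curve has to stay symmetric.\<close>

lemma has_sym_gradient_curve:
  fixes g :: "real^'n^'n \<Rightarrow> real"
  assumes g: "has_sym_gradient g (\<gamma> t) D"
    and \<gamma>: "(\<gamma> has_vector_derivative v) (at t)" and sym: "range \<gamma> \<subseteq> sym_mats"
  shows "((\<lambda>s. g (\<gamma> s)) has_real_derivative trace (D ** v)) (at t)"
proof -
  have "(g has_derivative (\<lambda>H. trace (D ** H))) (at (\<gamma> t) within range \<gamma>)"
    using g sym has_derivative_subset unfolding has_sym_gradient_def by blast
  from has_derivative_in_compose[OF \<gamma>[unfolded has_vector_derivative_def] this]
  have "((\<lambda>s. g (\<gamma> s)) has_derivative (\<lambda>s. trace (D ** (s *\<^sub>R v)))) (at t)" .
  moreover have "(\<lambda>s. trace (D ** (s *\<^sub>R v))) = (*) (trace (D ** v))"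
    by (simp add: fun_eq_iff matrix_scalar_ac trace_def sum_distrib_left
        scalar_matrix_assoc[symmetric] mult.commute)
  ultimately show ?thesis by (simp add: has_field_derivative_def)
qed

section \<open>From matrices to stable polynomials in the eigenvalues\<close>

lemma poly_map_poly_of_real:
  "poly (map_poly of_real q) (of_real t) = (of_real (poly q t) :: complex)"
  by (induction q) (simp_all add: map_poly_pCons)

text \<open>For fixed \<open>U\<close>, the linear map \<open>M\<close> sends the all-ones vector to
  the identity and exactly the positive orthant to positive definite matrices, so hyperbolicity and
  positivity of \<open>g\<close> pull back to the eigenvalues.\<close>

lemma garding_dirichlet_rhp_stable:
  fixes g :: "real^'n^'n \<Rightarrow> real"
  assumes gd: "garding_dirichlet N g" and U: "orthogonal_matrix U"
  obtains P where "rhp_stable N P"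
    and "\<And>x. P (cvec x) = of_real (g (U ** diagonal x ** transpose U))"
proof -
  define M where "M x = U ** diagonal x ** transpose U" for x
  have M: "linear M" "M 1 = mat 1" "\<And>x. M x \<in> sym_mats" "\<And>x. pos_def (M x) \<longleftrightarrow> (\<forall>i. x $ i > 0)"
    unfolding M_def[abs_def]
    by (simp_all only: linear_conj_diagonal conj_diagonal_1 sym_conj_diagonal pos_def_conj_diagonal U)
  have hp: "hom_poly_on_sym N g" and real_roots: "\<And>A. A \<in> sym_mats \<Longrightarrow> only_real_roots (line_poly g A)"
    and cone: "{A. pos_def A} \<subseteq> garding_cone g"
    using gd by (auto simp: garding_dirichlet_def I_hyperbolic_def)
  obtain p where p: "real_polynomial_function p" "\<And>A. A \<in> sym_mats \<Longrightarrow> g A = p A"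
    and scale: "\<And>A t. A \<in> sym_mats \<Longrightarrow> g (t *\<^sub>R A) = t ^ N * g A"
    using hp unfolding hom_poly_on_sym_def by blast
  have "polynomial_function M"
    by (intro polynomial_function_bounded_linear linear_conv_bounded_linear[THEN iffD1] M)
  \<comment> \<open>The polynomial \<open>p\<close> agrees with \<open>g\<close> on symmetric
    matrices, and \<open>M\<close> takes only such values, so complexifying the composite of
    \<open>p\<close> and \<open>M\<close> extends that of \<open>g\<close> and
    \<open>M\<close>.\<close>
  from real_polynomial_function_compose[OF this p(1)]
  obtain P where P: "real_cpoly P" "\<And>x. P (cvec x) = of_real ((p \<circ> M) x)"
    using complexify_real_polynomial by blast
  then have PM: "P (cvec x) = of_real (g (M x))" for x
    using p(2)[OF M(3)] by simp
  have pos: "g (M x) > 0" if "\<And>i. x $ i > 0" for x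
  proof -
    have "M x \<in> garding_cone g" using M(4) that cone by blast
    then show ?thesis
      using connected_component_subset[of "{A \<in> sym_mats. g A > 0}" "mat 1"]
      unfolding garding_cone_def by blast
  qed
  have hom: "P (s *s z) = s ^ N * P z" for s z
  proof (rule real_cpoly_homogeneous[OF P(1)])
    fix t :: real and x :: "real^'n"
    have "M (t *s x) = t *\<^sub>R M x"
      using linear_scale[OF M(1)] by (simp add: scalar_mult_eq_scaleR)
    then show "P (cvec (t *s x)) = of_real t ^ N * P (cvec x)"
      using scale[OF M(3)] by (simp add: PM)
  qed
  have hyp: "w \<in> \<real>" if w: "P (w *s cvec 1 + cvec x) = 0" for w x
  proof -
    obtain q where q: "\<And>s. P (cvec x + s *s cvec 1) = poly q s"
      using real_cpoly_line[OF P(1)] by blast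
    \<comment> \<open>Agreement at real \<open>t\<close> identifies the two complex polynomials, so
      the real-root condition on \<open>line_poly\<close> reaches the complex zero
      \<open>w\<close>.\<close>
    have "q = map_poly of_real (line_poly g (M x))"
    proof (rule poly_eq_if_eq_on_Reals)
      fix t :: real
      have "cvec x + of_real t *s cvec 1 = cvec (t *\<^sub>R 1 + x)"
        by (simp add: vec_eq_iff)
      then have "poly q (of_real t) = of_real (g (M (t *\<^sub>R 1 + x)))"
        by (simp only: q[symmetric] PM)
      also have "M (t *\<^sub>R 1 + x) = t *\<^sub>R mat 1 + M x"
        using M(1,2) by (simp add: linear_add linear_scale)
      also have "g \<dots> = poly (line_poly g (M x)) t"
        using poly_line_poly[OF hp M(3)] by simp
      also have "complex_of_real \<dots> = poly (map_poly of_real (line_poly g (M x))) (of_real t)"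
        by (simp add: poly_map_poly_of_real)
      finally show "poly q (of_real t) = poly (map_poly of_real (line_poly g (M x))) (of_real t)" .
    qed
    moreover have "poly q w = 0" using w q[of w] by (simp add: add.commute)
    ultimately show ?thesis using real_roots[OF M(3)] by (simp add: only_real_roots_def)
  qed
  have "rhp_stable N P"
    unfolding rhp_stable_def
    using P(1) hom hyperbolic_right_half_plane_nonzero[OF P(1) hom hyp] pos
    by (simp add: PM less_imp_neq[symmetric])
  then show ?thesis using that PM by (simp add: M_def)
qed

theorem theorem1p3:
  fixes g :: "real^'n^'n \<Rightarrow> real" and N :: nat and A :: "real^'n^'n"
  assumes "garding_dirichlet N g"
    and "I_central g"
    and "pos_def A"
  shows "g A powr (1 / real N) \<ge> g (mat 1) powr (1 / real N) * det A powr (1 / real CARD('n))"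
proof -
  have "transpose A = A" using assms(3) by (simp add: pos_def_def sym_mats_def)
  then obtain U x where U: "orthogonal_matrix U" and A: "A = U ** diagonal x ** transpose U"
    by (rule symmetric_matrix_diagonalizable)
  define M where "M x = U ** diagonal x ** transpose U" for x
  have M1: "M 1 = mat 1" and Msym: "range M \<subseteq> sym_mats" and Mlin: "linear M"
    using conj_diagonal_1[OF U] sym_conj_diagonal[OF U] linear_conj_diagonal[OF U]
    by (auto simp: M_def[abs_def])
  have x: "x $ i > 0" for i
    using assms(3) pos_def_conj_diagonal[OF U] by (simp add: A)
  obtain P where P: "rhp_stable N P" "\<And>x. P (cvec x) = of_real (g (M x))"
    using garding_dirichlet_rhp_stable[OF assms(1) U] unfolding M_def by metis
  have conv: "geo_mean_convex (\<lambda>x. g (M x))"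
    using rhp_stable_geo_mean_convex[OF P(1)] by (simp add: P(2))
  have pos: "g (M x) > 0" if "\<And>i. x $ i > 0" for x
  proof -
    have "Re (P (cvec x)) > 0" using P(1) that by (simp add: rhp_stable_def)
    then show ?thesis by (simp add: P(2))
  qed
  have gI: "g (mat 1) > 0" using pos[of 1] by (simp add: M1)
  obtain k where k: "k > 0" "has_sym_gradient g (mat 1) (k *\<^sub>R mat 1)"
    using assms(2) unfolding I_central_def by blast
  have scale: "g (t *\<^sub>R mat 1) = t ^ N * g (mat 1)" for t
    using assms(1) by (simp add: garding_dirichlet_def I_hyperbolic_def hom_poly_on_sym_def sym_mats_def)
  have k_trace: "trace ((k *\<^sub>R mat 1) ** B) = k * trace B" for B :: "real^'n^'n"
    by (simp add: scalar_matrix_assoc[symmetric] trace_def sum_distrib_left)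
  \<comment> \<open>Differentiating g(tI) = t^N g(I) at \<open>t = 1\<close>, once by the gradient
    kI and once directly, determines \<open>k\<close>.\<close>
  have euler: "real N * g (mat 1) = k * real CARD('n)"
  proof -
    have "((\<lambda>t. g (t *\<^sub>R mat 1)) has_real_derivative trace ((k *\<^sub>R mat 1) ** (mat 1 :: real^'n^'n))) (at 1)"
    proof (rule has_sym_gradient_curve[where \<gamma> = "\<lambda>t. t *\<^sub>R mat 1"])
      show "has_sym_gradient g (1 *\<^sub>R mat 1) (k *\<^sub>R mat 1)" using k(2) by simp
      show "((\<lambda>t. t *\<^sub>R mat 1) has_vector_derivative (mat 1 :: real^'n^'n)) (at 1)"
        by (auto intro!: derivative_eq_intros)
      show "range (\<lambda>t. t *\<^sub>R mat 1) \<subseteq> (sym_mats :: (real^'n^'n) set)"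
        by (auto simp: sym_mats_def transpose_scalar)
    qed
    then have "((\<lambda>t. t ^ N * g (mat 1)) has_real_derivative k * real CARD('n)) (at 1)"
      by (simp only: scale k_trace trace_I)
    moreover have "((\<lambda>t. t ^ N * g (mat 1)) has_real_derivative real N * g (mat 1)) (at 1)"
      by (rule derivative_eq_intros refl | simp)+
    ultimately show ?thesis using DERIV_unique by blast
  qed
  then have N: "N > 0" using k(1) by (cases N) auto
  \<comment> \<open>Logarithms of the eigenvalues: the exponential curve starts at the identity and
    reaches \<open>A\<close> at time 1.\<close>
  define \<xi> where "\<xi> = (\<chi> i. ln (x $ i))"
  have "((\<lambda>t. g (M (\<chi> i. exp (t * \<xi> $ i)))) has_real_derivative trace ((k *\<^sub>R mat 1) ** M \<xi>)) (at 0)"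
  proof (rule has_sym_gradient_curve[where \<gamma> = "\<lambda>t. M (\<chi> i. exp (t * \<xi> $ i))"])
    have "(\<chi> i. exp (0 * \<xi> $ i)) = 1" by (simp add: vec_eq_iff)
    then show "has_sym_gradient g (M (\<chi> i. exp (0 * \<xi> $ i))) (k *\<^sub>R mat 1)"
      using k(2) by (simp only: M1)
    have "((\<lambda>t. \<chi> i. exp (t * \<xi> $ i)) has_vector_derivative \<xi>) (at 0)"
      unfolding has_vector_derivative_def
    proof (subst has_derivative_componentwise_within, intro ballI)
      fix b :: "real^'n" assume "b \<in> Basis"
      then obtain i where b: "b = axis i 1" by (auto simp: Basis_vec_def)
      show "((\<lambda>t. (\<chi> i. exp (t * \<xi> $ i)) \<bullet> b) has_derivative (\<lambda>t. (t *\<^sub>R \<xi>) \<bullet> b)) (at 0)"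
        by (auto intro!: derivative_eq_intros simp: b inner_axis)
    qed
    then show "((\<lambda>t. M (\<chi> i. exp (t * \<xi> $ i))) has_vector_derivative M \<xi>) (at 0)"
      using bounded_linear.has_vector_derivative Mlin linear_conv_bounded_linear by blast
    show "range (\<lambda>t. M (\<chi> i. exp (t * \<xi> $ i))) \<subseteq> sym_mats" using Msym by blast
  qed
  then have "ln (g (M 1)) + k * trace (M \<xi>) / g (M 1) \<le> ln (g (M (\<chi> i. exp (\<xi> $ i))))"
    using geo_mean_convex_tangent[OF conv pos] by (simp add: k_trace)
  moreover have "M (\<chi> i. exp (\<xi> $ i)) = A"
    using x by (simp add: \<xi>_def A M_def)
  moreover have "det A > 0" and "trace (M \<xi>) = ln (det A)"
    using x by (simp_all add: A M_def \<xi>_def det_conj_diagonal[OF U] trace_conj_diagonal[OF U]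
        prod_pos ln_prod less_imp_neq[symmetric])
  \<comment> \<open>Eliminating \<open>k\<close> turns the tangent slope into N/n times
    \<open>ln (det A)\<close>.\<close>
  moreover have "k / g (mat 1) = real N / real CARD('n)"
    using euler gI by (simp add: field_simps)
  ultimately have main: "ln (g (mat 1)) + real N / real CARD('n) * ln (det A) \<le> ln (g A)"
    by (metis M1 times_divide_eq_left mult.commute)
  have "g A > 0" using pos x by (simp add: A M_def)
  have "ln (g (mat 1)) / real N + ln (det A) / real CARD('n) \<le> ln (g A) / real N"
    using divide_right_mono[OF main, of "real N"] N by (simp add: add_divide_distrib)
  then show ?thesis
    using \<open>g A > 0\<close> \<open>det A > 0\<close> gI by (simp add: powr_def flip: exp_add)
qed

end
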